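(* Let $B$ be the inequality constraint matrix corresponding to (Rank) or (MWF) over a graph $G=(V,E)$. Then $\kappa(0,B)\in\Omega(2^{|E|})$.
   Context: For a simple graph $G=(V,E)$ and variables $x\in\mathbb{R}^{E}$, (Rank) is the system $$\sum_{e\in E(G[U])}x(e)\le |U|-1\quad\text{for all }\emptyset\neq U\subseteq V,$$ where $G[U]$ is the subgraph of $G$ induced by $U$, and (MWF) is the system consisting of all inequalities of (Rank) together with $x(e)\ge0$ for all $e\in E$. For a real matrix $B$ with $n$ columns, the set of circuits $\mathcal{C}(0,B)$ consists of the vectors $g\in\mathbb{R}^n\setminus\{0\}$, normalized to coprime integer components, for which $Bg$ is support-minimal over $\{Bx : x\in\mathbb{R}^n\setminus\{0\}\}$. The circuit imbalance measure is $\kappa(0,B)=\max\{|g(i)/g(j)| : g\in\mathcal{C}(0,B),\ g(j)\neq0\}$. For $f,g:\mathbb{Z}^+\to\mathbb{R}^+$, $f(n)\in\Omega(g(n))$ means that there exist a real constant $c>0$ and an integer constant $n_0\ge1$ such that $f(n)\ge c\cdot g(n)$ for every integer $n\ge n_0$. The bound is a worst-case statement over graphs: $\kappa(0,B)$ is regarded as a function of the number $|E|$ of edges by taking the maximum over graphs with that number of edges. *)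

theory Defs
  imports Complex_Main "HOL-Library.Landau_Symbols"
begin

section \<open>Circuits and circuit imbalance\<close>

text \<open>
  A real matrix is a coefficient function \<open>B :: 'r \<Rightarrow> 'c \<Rightarrow> real\<close> together with finite index sets
  \<open>R\<close> of rows and \<open>C\<close> of columns. Vectors of the space with coordinates in \<open>C\<close> are functions
  vanishing outside \<open>C\<close>, so that function equality is vector equality.
\<close>

definition vecs :: "'c set \<Rightarrow> ('c \<Rightarrow> real) set" where
  "vecs C = {x. \<forall>c. c \<notin> C \<longrightarrow> x c = 0}"

definition mat_vec :: "'c set \<Rightarrow> ('r \<Rightarrow> 'c \<Rightarrow> real) \<Rightarrow> ('c \<Rightarrow> real) \<Rightarrow> 'r \<Rightarrow> real" where
  "mat_vec C B x r = (\<Sum>c\<in>C. B r c * x c)"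

definition supp :: "'r set \<Rightarrow> ('r \<Rightarrow> real) \<Rightarrow> 'r set" where
  "supp R y = {r \<in> R. y r \<noteq> 0}"

definition coprime_integral :: "'c set \<Rightarrow> ('c \<Rightarrow> real) \<Rightarrow> bool" where
  "coprime_integral C g \<longleftrightarrow>
     (\<exists>z :: 'c \<Rightarrow> int. (\<forall>c\<in>C. g c = of_int (z c)) \<and> Gcd (z ` C) = 1)"

definition circuits :: "'r set \<Rightarrow> 'c set \<Rightarrow> ('r \<Rightarrow> 'c \<Rightarrow> real) \<Rightarrow> ('c \<Rightarrow> real) set" where
  "circuits R C B =
     {g \<in> vecs C - {\<lambda>_. 0}. coprime_integral C g \<and>
        \<not> (\<exists>x \<in> vecs C - {\<lambda>_. 0}. supp R (mat_vec C B x) \<subset> supp R (mat_vec C B g))}"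

definition circuit_imbalance :: "'r set \<Rightarrow> 'c set \<Rightarrow> ('r \<Rightarrow> 'c \<Rightarrow> real) \<Rightarrow> real" where
  "circuit_imbalance R C B =
     Max {\<bar>g i / g j\<bar> | g i j. g \<in> circuits R C B \<and> i \<in> C \<and> j \<in> C \<and> g j \<noteq> 0}"

section \<open>The constraint matrices of (Rank) and (MWF)\<close>

text \<open>
  (Rank) consists of \<open>(\<Sum>e\<in>induced_edges E U. x e) \<le> card U - 1\<close> for all nonempty \<open>U \<subseteq> V\<close>, and
  (MWF) adds \<open>x e \<ge> 0\<close> for all \<open>e \<in> E\<close>; only the left-hand sides enter the constraint matrices.
\<close>

definition simple_graph :: "'v set \<Rightarrow> 'v set set \<Rightarrow> bool" where
  "simple_graph V E \<longleftrightarrow> finite V \<and> (\<forall>e\<in>E. e \<subseteq> V \<and> card e = 2)"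

definition induced_edges :: "'v set set \<Rightarrow> 'v set \<Rightarrow> 'v set set" where
  "induced_edges E U = {e \<in> E. e \<subseteq> U}"

definition rank_rows :: "'v set \<Rightarrow> 'v set set" where
  "rank_rows V = {U. U \<subseteq> V \<and> U \<noteq> {}}"

definition rank_matrix :: "'v set set \<Rightarrow> 'v set \<Rightarrow> 'v set \<Rightarrow> real" where
  "rank_matrix E U e = (if e \<in> induced_edges E U then 1 else 0)"

text \<open>
  The rows of (MWF) are those of (Rank), tagged \<open>Inl\<close>, and one row per edge, tagged \<open>Inr\<close>, for the
  nonnegativity constraint written as \<open>- x(e) \<le> 0\<close>.
\<close>

definition mwf_rows :: "'v set \<Rightarrow> 'v set set \<Rightarrow> ('v set + 'v set) set" where
  "mwf_rows V E = rank_rows V <+> E"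

fun mwf_matrix :: "'v set set \<Rightarrow> 'v set + 'v set \<Rightarrow> 'v set \<Rightarrow> real" where
  "mwf_matrix E (Inl U) e = rank_matrix E U e"
| "mwf_matrix E (Inr f) e = (if e = f then -1 else 0)"

definition rank_kappa :: "'v set \<Rightarrow> 'v set set \<Rightarrow> real" where
  "rank_kappa V E = circuit_imbalance (rank_rows V) E (rank_matrix E)"

definition mwf_kappa :: "'v set \<Rightarrow> 'v set set \<Rightarrow> real" where
  "mwf_kappa V E = circuit_imbalance (mwf_rows V E) E (mwf_matrix E)"

text \<open>
  Every finite simple graph is isomorphic to one whose vertices are natural numbers, so the maximum
  over all graphs with \<open>m\<close> edges is taken over those. There are infinitely many of them, but only
  finitely many values: for fixed \<open>m\<close>, up to renaming of the edges, only finitely many sets of rows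
  occur.
\<close>

definition worst_case :: "(nat set \<Rightarrow> nat set set \<Rightarrow> real) \<Rightarrow> nat \<Rightarrow> real" where
  "worst_case \<kappa> m = Max {\<kappa> V E | V E. simple_graph V E \<and> card E = m}"

end

theory Submission
  imports Defs "HOL-Library.FuncSet"
begin

text \<open>
  In a star every set of edges is induced by some set of vertices, namely by the centre and the outer
  endpoints of these edges. The rows of (Rank) are therefore all 0/1 vectors, and the further rows of
  (MWF), being negated unit vectors, do not change which vectors are circuits. An integer vector with
  an entry 1 is a circuit of the star as soon as its zero-sum sets of entries determine it up to
  scaling, because any vector whose image has smaller support vanishes on these sets as well. So it
  suffices to find, for every \<open>m\<close>, such a vector of length \<open>m\<close> with an entry of order \<open>2 ^ m\<close>.

  The obvious recursion, where each new entry is minus a sum of earlier ones, gives Fibonacci growth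
  at best: a sum that produces a positive entry can use negative entries only, and conversely. More is
  gained by adding several entries at once through a system of equations. The entries of \<open>block\<close> are
  ten integers that are determined by those subsets whose sum is \<open>1\<close> or \<open>-1\<close>
  (\<open>block_determined_by_unit_sums\<close>), and that have subsets with sums \<open>1024\<close> and \<open>-1024\<close>. If a vector
  has subsets with sums \<open>s\<close> and \<open>-s\<close>, then appending \<open>s\<close> times the block gives a vector
  that is again determined by its zero-sum subsets: every unit-sum subset of the block is completed to
  a zero-sum subset by one of these two (\<open>zero_sum_determined_append_block\<close>). The
  longer vector has subsets with sums \<open>1024 * s\<close> and \<open>-1024 * s\<close>. Ten further edges thus gain a factor
  \<open>2 ^ 10\<close>, starting from the vector \<open>(1, -1)\<close> with \<open>s = 1\<close>; lengths in between are filled up by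
  zeros, at the cost of a constant factor.

  To pass from one circuit to the maxima in \<open>circuit_imbalance\<close> and \<open>worst_case\<close>, these have to be
  maxima of finite sets. A circuit spans the common kernel of the rows on which it vanishes, so a
  ratio of two of its entries depends only on a set of vectors with entries in \<open>{-1, 0, 1}\<close> and two
  positions. For a fixed number of edges there are finitely many of these, whatever the graph
  (\<open>finite_kernel_ratios\<close>, \<open>circuit_ratio_in_kernel_ratios\<close>).
\<close>

section \<open>Integer vectors determined by their zero-sum subsets\<close>

definition zero_sum_determined :: "nat \<Rightarrow> (nat \<Rightarrow> int) \<Rightarrow> bool" where
  "zero_sum_determined m a \<longleftrightarrow>
     (\<forall>x :: nat \<Rightarrow> real. (\<forall>S \<subseteq> {..<m}. sum a S = 0 \<longrightarrow> sum x S = 0) \<longrightarrow>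
        (\<exists>c. \<forall>i<m. x i = c * of_int (a i)))"

lemma zero_sum_determined_append_zero:
  assumes "zero_sum_determined m a" "a m = 0"
  shows "zero_sum_determined (Suc m) a"
  unfolding zero_sum_determined_def
proof (intro allI impI)
  fix x :: "nat \<Rightarrow> real"
  assume x: "\<forall>S \<subseteq> {..<Suc m}. sum a S = 0 \<longrightarrow> sum x S = 0"
  have "\<forall>S \<subseteq> {..<m}. sum a S = 0 \<longrightarrow> sum x S = 0"
    using x by (meson lessThan_subset_iff less_imp_le lessI subset_trans)
  then obtain c where c: "\<forall>i<m. x i = c * of_int (a i)"
    using assms(1) unfolding zero_sum_determined_def by blast
  have "x m = 0"
    using x[rule_format, of "{m}"] assms(2) by simp
  then have "\<forall>i<Suc m. x i = c * of_int (a i)"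
    using c assms(2) by (simp add: less_Suc_eq)
  then show "\<exists>c. \<forall>i<Suc m. x i = c * of_int (a i)" ..
qed

text \<open>
  The numbers come from a computer search for ten integers \<open>f\<close> such that the subsets with sum
  \<open>1\<close> or \<open>-1\<close> determine \<open>f\<close>, while \<open>2 ^ 10\<close> and \<open>- (2 ^ 10)\<close> are subset sums. These two sums carry the
  scale to the next block, so \<open>2 ^ 10\<close>, with the length of the block as exponent, is what the bound
  \<open>2 ^ m\<close> requires.
\<close>

definition block :: "nat \<Rightarrow> int" where
  "block i = [285, -325, 127, -268, -200, -169, 430, -88, 351, -189] ! i"

text \<open>
  The ten subsets below are all nonempty subsets of the block with a sum of absolute value at most 1.
  Their incidence matrix is nonsingular, and the block solves the resulting linear system for \<open>t = 1\<close>.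
\<close>

lemma block_determined_by_unit_sums:
  fixes y :: "nat \<Rightarrow> real" and t :: real
  assumes unit: "\<And>R. R \<subseteq> {..<10} \<Longrightarrow> \<bar>sum block R\<bar> = 1 \<Longrightarrow> sum y R = t * of_int (sum block R)"
    and i: "i < 10"
  shows "y i = t * of_int (block i)"
proof -
  have "y 1 + y 4 + y 5 + y 6 + y 7 + y 8 = -t"
    using unit[of "{1,4,5,6,7,8}"] by (simp add: block_def)
  moreover have "y 1 + y 3 + y 6 + y 8 + y 9 = -t"
    using unit[of "{1,3,6,8,9}"] by (simp add: block_def)
  moreover have "y 2 + y 3 + y 4 + y 6 + y 7 = t"
    using unit[of "{2,3,4,6,7}"] by (simp add: block_def)
  moreover have "y 0 + y 1 + y 4 + y 6 + y 9 = t"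
    using unit[of "{0,1,4,6,9}"] by (simp add: block_def)
  moreover have "y 0 + y 1 + y 2 + y 3 + y 5 + y 8 = t"
    using unit[of "{0,1,2,3,5,8}"] by (simp add: block_def)
  moreover have "y 2 + y 4 + y 7 + y 8 + y 9 = t"
    using unit[of "{2,4,7,8,9}"] by (simp add: block_def)
  moreover have "y 0 + y 3 + y 4 + y 5 + y 8 = -t"
    using unit[of "{0,3,4,5,8}"] by (simp add: block_def)
  moreover have "y 0 + y 1 + y 2 + y 7 = -t"
    using unit[of "{0,1,2,7}"] by (simp add: block_def)
  moreover have "y 2 + y 4 + y 5 + y 6 + y 9 = -t"
    using unit[of "{2,4,5,6,9}"] by (simp add: block_def)
  moreover have "y 0 + y 3 + y 5 + y 6 + y 7 + y 9 = t"
    using unit[of "{0,3,5,6,7,9}"] by (simp add: block_def)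
  ultimately have
    "y 0 = 285 * t" "y 1 = -325 * t" "y 2 = 127 * t" "y 3 = -268 * t" "y 4 = -200 * t"
    "y 5 = -169 * t" "y 6 = 430 * t" "y 7 = -88 * t" "y 8 = 351 * t" "y 9 = -189 * t"
    by algebra+
  moreover have "i \<in> {0, 1, 2, 3, 4, 5, 6, 7, 8, 9}"
    using i by auto
  ultimately show ?thesis
    by (auto simp: block_def)
qed

definition append_block :: "nat \<Rightarrow> (nat \<Rightarrow> int) \<Rightarrow> int \<Rightarrow> nat \<Rightarrow> int" where
  "append_block m a s i = (if i < m then a i else s * block (i - m))"

lemma sum_append_block:
  fixes x :: "nat \<Rightarrow> 'a::comm_monoid_add"
  assumes "S \<subseteq> {..<m}" "R \<subseteq> {..<n}"
  shows "sum x (S \<union> (+) m ` R) = sum x S + (\<Sum>i\<in>R. x (m + i))"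
proof -
  have "finite S" "finite R"
    using assms finite_subset by blast+
  then have "sum x (S \<union> (+) m ` R) = sum x S + sum x ((+) m ` R)"
    using assms by (intro sum.union_disjoint) auto
  then show ?thesis
    by (simp add: sum.reindex)
qed

lemma sum_append_block_append:
  assumes "S \<subseteq> {..<m}" "R \<subseteq> {..<n}"
  shows "sum (append_block m a s) (S \<union> (+) m ` R) = sum a S + s * sum block R"
proof -
  have "sum (append_block m a s) S = sum a S"
    using assms by (intro sum.cong) (auto simp: append_block_def)
  then show ?thesis
    using sum_append_block[OF assms, of "append_block m a s"]
    by (simp add: append_block_def sum_distrib_left)
qed

text \<open>
  A unit-sum subset of the block has sum \<open>s\<close> or \<open>-s\<close> after scaling, and is cancelled by \<open>S'\<close> or \<open>S\<close>.
  Hence a vector \<open>x\<close> that vanishes on all zero-sum subsets, and that is \<open>c\<close> times the old vector on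
  the old entries, satisfies on the new ones the system that characterizes \<open>c * s\<close> times the block.
\<close>

lemma zero_sum_determined_append_block:
  assumes det: "zero_sum_determined m a"
    and S: "S \<subseteq> {..<m}" "sum a S = s" and S': "S' \<subseteq> {..<m}" "sum a S' = - s"
  shows "zero_sum_determined (m + 10) (append_block m a s)"
  unfolding zero_sum_determined_def
proof (intro allI impI)
  fix x :: "nat \<Rightarrow> real"
  assume x: "\<forall>S \<subseteq> {..<m + 10}. sum (append_block m a s) S = 0 \<longrightarrow> sum x S = 0"
  have zero: "sum x T + (\<Sum>i\<in>R. x (m + i)) = 0"
    if "T \<subseteq> {..<m}" "R \<subseteq> {..<10}" "sum a T + s * sum block R = 0" for T R
  proof -
    have "T \<union> (+) m ` R \<subseteq> {..<m + 10}"
      using that by force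
    then show ?thesis
      using x[rule_format, of "T \<union> (+) m ` R"] sum_append_block[OF that(1,2), of x]
        sum_append_block_append[OF that(1,2), of a s] that(3) by simp
  qed
  have "\<forall>T \<subseteq> {..<m}. sum a T = 0 \<longrightarrow> sum x T = 0"
    using zero[of _ "{}"] by auto
  then obtain c where c: "\<forall>i<m. x i = c * of_int (a i)"
    using det unfolding zero_sum_determined_def by blast
  have old: "sum x T = c * of_int (sum a T)" if "T \<subseteq> {..<m}" for T
    using c that by (auto simp: sum_distrib_left intro!: sum.cong)
  have unit: "(\<Sum>i\<in>R. x (m + i)) = (c * of_int s) * of_int (sum block R)"
    if R: "R \<subseteq> {..<10}" "\<bar>sum block R\<bar> = 1" for R
  proof -
    have "\<exists>T \<subseteq> {..<m}. sum a T + s * sum block R = 0"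
      using R(2) S S' by (cases "sum block R = 1") (auto simp: abs_if split: if_splits)
    then obtain T where T: "T \<subseteq> {..<m}" "sum a T + s * sum block R = 0"
      by blast
    have "sum a T = - s * sum block R"
      using T(2) by simp
    then have "sum x T = - (c * of_int s) * of_int (sum block R)"
      using old[OF T(1)] by (simp del: of_int_sum)
    then show ?thesis
      using zero[OF T(1) R(1) T(2)] by simp
  qed
  have "x i = c * of_int (append_block m a s i)" if "i < m + 10" for i
  proof (cases "i < m")
    case True
    then show ?thesis
      using c by (simp add: append_block_def)
  next
    case False
    then have "x (m + (i - m)) = (c * of_int s) * of_int (block (i - m))"
      using that by (intro block_determined_by_unit_sums[where y = "\<lambda>i. x (m + i)"] unit) auto
    then show ?thesis
      using False by (simp add: append_block_def)
  qed
  then show "\<exists>c. \<forall>i<m + 10. x i = c * of_int (append_block m a s i)"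
    by blast
qed

text \<open>
  The subsets with sums \<open>\<plusminus>2 ^ (10 * T)\<close> feed the next step. A single large entry has to be tracked
  as well, since large subset sums alone would lose a factor of the length of the vector. The factor 4
  is what the start \<open>(1, -1)\<close> and the entry \<open>430 \<ge> 1024 / 4\<close> of the block allow.
\<close>

lemma exists_zero_sum_determined_blocks:
  "\<exists>a. zero_sum_determined (2 + 10 * T) a \<and> a 0 = 1 \<and>
     (\<exists>S \<subseteq> {..<2 + 10 * T}. sum a S = 2 ^ (10 * T)) \<and>
     (\<exists>S \<subseteq> {..<2 + 10 * T}. sum a S = - (2 ^ (10 * T))) \<and>
     (\<exists>i < 2 + 10 * T. 2 ^ (10 * T) \<le> 4 * \<bar>a i\<bar>)"
proof (induction T)
  case 0
  define a :: "nat \<Rightarrow> int" where "a i = (if i = 0 then 1 else -1)" for i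
  have "zero_sum_determined 2 a"
    unfolding zero_sum_determined_def
  proof (intro allI impI)
    fix x :: "nat \<Rightarrow> real"
    assume "\<forall>S \<subseteq> {..<2}. sum a S = 0 \<longrightarrow> sum x S = 0"
    then have "x 0 + x 1 = 0"
      by (auto dest!: spec[of _ "{0, 1}"] simp: a_def)
    then have "\<forall>i<2. x i = x 0 * of_int (a i)"
      by (auto simp: a_def less_2_cases_iff)
    then show "\<exists>c. \<forall>i<2. x i = c * of_int (a i)" ..
  qed
  moreover have "\<exists>S \<subseteq> {..<2}. sum a S = 1" "\<exists>S \<subseteq> {..<2}. sum a S = -1"
    by (intro exI[of _ "{0}"] exI[of _ "{1}"]; simp add: a_def)+
  moreover have "a 0 = 1"
    by (simp add: a_def)
  ultimately show ?case
    by (intro exI[of _ a] conjI exI[of _ 0]) simp_all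
next
  case (Suc T)
  let ?m = "2 + 10 * T" and ?s = "2 ^ (10 * T) :: int"
  obtain a S S' where a: "zero_sum_determined ?m a" "a 0 = 1"
    and S: "S \<subseteq> {..<?m}" "sum a S = ?s" and S': "S' \<subseteq> {..<?m}" "sum a S' = - ?s"
    using Suc.IH by blast
  let ?b = "append_block ?m a ?s"
  have m: "2 + 10 * Suc T = ?m + 10" and s: "2 ^ (10 * Suc T) = 1024 * ?s"
    by (auto simp: power_add)
  have pos: "(+) ?m ` {0, 2, 5, 6, 8} \<subseteq> {..<?m + 10}"
    and neg: "(+) ?m ` {1, 2, 3, 4, 5, 9} \<subseteq> {..<?m + 10}"
    by auto
  \<comment> \<open>These subsets of the block have sums \<open>1024\<close> and \<open>-1024\<close>; its entry 6 is 430.\<close>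
  have "sum ?b ((+) ?m ` {0, 2, 5, 6, 8}) = 1024 * ?s"
    using sum_append_block_append[of "{}" ?m "{0, 2, 5, 6, 8}" 10 a ?s] by (simp add: block_def)
  moreover have "sum ?b ((+) ?m ` {1, 2, 3, 4, 5, 9}) = - (1024 * ?s)"
    using sum_append_block_append[of "{}" ?m "{1, 2, 3, 4, 5, 9}" 10 a ?s] by (simp add: block_def)
  moreover have "1024 * ?s \<le> 4 * \<bar>?b (?m + 6)\<bar>"
    by (simp add: append_block_def block_def)
  moreover have "?b 0 = 1"
    using a(2) by (simp add: append_block_def)
  moreover have "zero_sum_determined (?m + 10) ?b"
    using zero_sum_determined_append_block[OF a(1) S S'] .
  moreover have "?m + 6 < ?m + 10"
    by simp
  ultimately show ?case
    unfolding m s using pos neg by blast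
qed

lemma zero_sum_determined_cong:
  assumes "zero_sum_determined m a" "\<And>i. i < m \<Longrightarrow> a i = b i"
  shows "zero_sum_determined m b"
proof -
  have "sum a S = sum b S" if "S \<subseteq> {..<m}" for S
    using assms(2) that by (intro sum.cong) auto
  then show ?thesis
    using assms unfolding zero_sum_determined_def by simp
qed

lemma zero_sum_determined_pad:
  assumes "zero_sum_determined m a"
  shows "zero_sum_determined (m + k) (\<lambda>i. if i < m then a i else 0)"
proof (induction k)
  case 0
  show ?case
    using zero_sum_determined_cong[OF assms] by simp
next
  case (Suc k)
  then show ?case
    using zero_sum_determined_append_zero[OF Suc] by simp
qed

text \<open>
  Rounding the length \<open>m\<close> down to one of the form \<open>2 + 10 * T\<close> loses at most \<open>2 ^ 11\<close>: two entries for
  the start and up to nine for padding. The entry itself is smaller than \<open>2 ^ (10 * T)\<close> by a factor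
  of at most 4.
\<close>

lemma exists_zero_sum_determined_large:
  assumes "m \<ge> 2"
  shows "\<exists>a. zero_sum_determined m a \<and> a 0 = 1 \<and> (\<exists>i<m. (2::int) ^ m \<le> 2 ^ 13 * \<bar>a i\<bar>)"
proof -
  define T k where "T = (m - 2) div 10" and "k = (m - 2) mod 10"
  have m: "m = 2 + 10 * T + k" and "k \<le> 9"
    using assms by (auto simp: T_def k_def)
  obtain a i where a: "zero_sum_determined (2 + 10 * T) a" "a 0 = 1"
    and i: "i < 2 + 10 * T" "2 ^ (10 * T) \<le> 4 * \<bar>a i\<bar>"
    using exists_zero_sum_determined_blocks[of T] by blast
  have "(2::int) ^ m = 2 ^ (2 + k) * 2 ^ (10 * T)"
    by (simp add: m power_add)
  also have "\<dots> \<le> 2 ^ 11 * (4 * \<bar>a i\<bar>)"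
    using i(2) \<open>k \<le> 9\<close> by (intro mult_mono power_increasing) auto
  finally have "(2::int) ^ m \<le> 2 ^ 13 * \<bar>a i\<bar>"
    by simp
  moreover have "i < m"
    using i(1) m by simp
  ultimately show ?thesis
    using zero_sum_determined_pad[OF a(1), of k] a(2) i(1) unfolding m[symmetric]
    by (intro exI[of _ "\<lambda>i. if i < 2 + 10 * T then a i else 0"]) auto
qed

section \<open>Finitely many circuit ratios\<close>

text \<open>
  For \<open>h\<close> that is zero on \<open>{..<m}\<close> this says that the kernel is trivial; the quotients below are then
  \<open>0 / 0 = 0\<close>, so this case contributes at most one value.
\<close>

definition spans_kernel :: "nat \<Rightarrow> (nat \<Rightarrow> real) set \<Rightarrow> (nat \<Rightarrow> real) \<Rightarrow> bool" where
  "spans_kernel m Z h \<longleftrightarrow> (\<forall>z\<in>Z. (\<Sum>l<m. z l * h l) = 0) \<and>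
     (\<forall>x. (\<forall>z\<in>Z. (\<Sum>l<m. z l * x l) = 0) \<longrightarrow> (\<exists>c. \<forall>l<m. x l = c * h l))"

definition kernel_ratios :: "nat \<Rightarrow> real set" where
  "kernel_ratios m = (\<Union>Z \<in> Pow ({..<m} \<rightarrow>\<^sub>E {-1, 0, 1}). \<Union>i<m. \<Union>j<m.
     {\<bar>h i / h j\<bar> | h. spans_kernel m Z h})"

text \<open>
  Any two vectors that span the same kernel are multiples of each other, so for fixed \<open>Z\<close>, \<open>i\<close> and \<open>j\<close>
  there is at most one ratio.
\<close>

lemma finite_kernel_ratios: "finite (kernel_ratios m)"
proof -
  have "finite {\<bar>h i / h j\<bar> | h. spans_kernel m Z h}" if "i < m" "j < m" for Z i j
  proof -
    have "\<bar>h i / h j\<bar> = \<bar>h' i / h' j\<bar>" if "spans_kernel m Z h" "spans_kernel m Z h'" for h h'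
    proof -
      obtain c where "\<forall>l<m. h l = c * h' l"
        using \<open>spans_kernel m Z h\<close> \<open>spans_kernel m Z h'\<close> unfolding spans_kernel_def by blast
      moreover obtain d where "\<forall>l<m. h' l = d * h l"
        using \<open>spans_kernel m Z h\<close> \<open>spans_kernel m Z h'\<close> unfolding spans_kernel_def by blast
      ultimately show ?thesis
        using \<open>i < m\<close> \<open>j < m\<close> by (cases "c = 0") auto
    qed
    then have "\<exists>q. {\<bar>h i / h j\<bar> | h. spans_kernel m Z h} \<subseteq> {q}"
      by blast
    then show ?thesis
      by (meson finite.emptyI finite.insertI finite_subset)
  qed
  then show ?thesis
    unfolding kernel_ratios_def by (intro finite_UN_I) (auto intro: finite_PiE)
qed

text \<open>
  If \<open>y\<close> vanishes on all rows where the circuit \<open>g\<close> vanishes, subtract the multiple of \<open>g\<close> that makes the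
  difference vanish on one more row \<open>r0\<close>. The support of the image has become strictly smaller,
  so minimality forces the difference to be zero. Injectivity supplies \<open>r0\<close>: for a matrix with a
  nontrivial kernel the circuits could fill a space of higher dimension, with unbounded ratios.
\<close>

lemma circuit_ratio_in_kernel_ratios:
  fixes B :: "'r \<Rightarrow> 'c \<Rightarrow> real"
  assumes C: "finite C" "card C = m"
    and entries: "\<And>r c. r \<in> R \<Longrightarrow> c \<in> C \<Longrightarrow> B r c \<in> {-1, 0, 1}"
    and inj: "\<And>x. x \<in> vecs C \<Longrightarrow> x \<noteq> (\<lambda>_. 0) \<Longrightarrow> \<exists>r\<in>R. mat_vec C B x r \<noteq> 0"
    and g: "g \<in> circuits R C B" and ij: "i \<in> C" "j \<in> C"
  shows "\<bar>g i / g j\<bar> \<in> kernel_ratios m"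
proof -
  obtain e where e: "bij_betw e {..<m} C"
    using ex_bij_betw_nat_finite[OF C(1)] C(2) by (auto simp: atLeast0LessThan)
  define row where "row r = restrict (\<lambda>l. B r (e l)) {..<m}" for r
  define Z where "Z = row ` {r \<in> R. mat_vec C B g r = 0}"
  have prod: "(\<Sum>l<m. row r l * x (e l)) = mat_vec C B x r" for r x
    unfolding mat_vec_def row_def by (simp flip: sum.reindex_bij_betw[OF e])
  have g': "g \<in> vecs C" "g \<noteq> (\<lambda>_. 0)"
    and minimal: "\<not> (\<exists>x \<in> vecs C - {\<lambda>_. 0}. supp R (mat_vec C B x) \<subset> supp R (mat_vec C B g))"
    using g by (auto simp: circuits_def)
  obtain r0 where r0: "r0 \<in> R" "mat_vec C B g r0 \<noteq> 0"
    using inj[OF g'] by blast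
  have spans: "spans_kernel m Z (\<lambda>l. g (e l))"
    unfolding spans_kernel_def
  proof (intro conjI allI impI)
    show "\<forall>z\<in>Z. (\<Sum>l<m. z l * g (e l)) = 0"
      by (auto simp: Z_def prod)
  next
    fix x :: "nat \<Rightarrow> real"
    assume x: "\<forall>z\<in>Z. (\<Sum>l<m. z l * x l) = 0"
    define y where "y c = (if c \<in> C then x (the_inv_into {..<m} e c) else 0)" for c
    have y: "y (e l) = x l" if "l < m" for l
      using e that by (auto simp: y_def bij_betw_def the_inv_into_f_f)
    define d where "d = mat_vec C B y r0 / mat_vec C B g r0"
    define w where "w c = y c - d * g c" for c
    have Bw: "mat_vec C B w r = mat_vec C B y r - d * mat_vec C B g r" for r
      by (simp add: w_def mat_vec_def algebra_simps sum_subtractf sum_distrib_left)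
    have By: "mat_vec C B y r = 0" if "r \<in> R" "mat_vec C B g r = 0" for r
    proof -
      have "(\<Sum>l<m. row r l * x l) = 0"
        using x that by (auto simp: Z_def)
      then show ?thesis
        unfolding prod[symmetric] using y by simp
    qed
    have "supp R (mat_vec C B w) \<subset> supp R (mat_vec C B g)"
    proof
      show "supp R (mat_vec C B w) \<subseteq> supp R (mat_vec C B g)"
        using By by (auto simp: supp_def Bw)
      show "supp R (mat_vec C B w) \<noteq> supp R (mat_vec C B g)"
      proof
        assume "supp R (mat_vec C B w) = supp R (mat_vec C B g)"
        then have "r0 \<in> supp R (mat_vec C B w)"
          using r0 by (simp add: supp_def)
        then show False
          using r0 by (simp add: supp_def Bw d_def)
      qed
    qed
    moreover have "w \<in> vecs C"
      using g'(1) by (auto simp: vecs_def w_def y_def)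
    ultimately have "w = (\<lambda>_. 0)"
      using minimal by blast
    then have "\<forall>l<m. x l = d * g (e l)"
      using y by (auto simp: w_def fun_eq_iff)
    then show "\<exists>c. \<forall>l<m. x l = c * g (e l)" ..
  qed
  have "row r \<in> {..<m} \<rightarrow>\<^sub>E {-1, 0, 1}" if "r \<in> R" for r
    unfolding row_def restrict_PiE_iff using entries[OF that] bij_betwE[OF e] by blast
  then have Z: "Z \<in> Pow ({..<m} \<rightarrow>\<^sub>E {-1, 0, 1})"
    by (auto simp: Z_def)
  obtain i' j' where idx: "i' < m" "e i' = i" "j' < m" "e j' = j"
    using ij e unfolding bij_betw_def by (metis imageE lessThan_iff)
  have "\<bar>g i / g j\<bar> \<in> {\<bar>h i' / h j'\<bar> | h. spans_kernel m Z h}"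
    using spans idx by (intro CollectI exI[of _ "\<lambda>l. g (e l)"]) simp
  then show ?thesis
    unfolding kernel_ratios_def using Z idx by blast
qed

text \<open>
  The value \<open>Max {}\<close> covers a matrix without circuits. It is one fixed number, so allowing it
  keeps the set of possible imbalances finite.
\<close>

lemma circuit_imbalance_bounds:
  fixes B :: "'r \<Rightarrow> 'c \<Rightarrow> real"
  assumes "finite C" "card C = m"
    and "\<And>r c. r \<in> R \<Longrightarrow> c \<in> C \<Longrightarrow> B r c \<in> {-1, 0, 1}"
    and "\<And>x. x \<in> vecs C \<Longrightarrow> x \<noteq> (\<lambda>_. 0) \<Longrightarrow> \<exists>r\<in>R. mat_vec C B x r \<noteq> 0"
  shows "circuit_imbalance R C B \<in> insert (Max {}) (kernel_ratios m)"
    and "\<lbrakk>g \<in> circuits R C B; i \<in> C; j \<in> C; g j \<noteq> 0\<rbrakk> \<Longrightarrow> \<bar>g i / g j\<bar> \<le> circuit_imbalance R C B"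
proof -
  define A where "A = {\<bar>g i / g j\<bar> | g i j. g \<in> circuits R C B \<and> i \<in> C \<and> j \<in> C \<and> g j \<noteq> 0}"
  have "A \<subseteq> kernel_ratios m"
    unfolding A_def using circuit_ratio_in_kernel_ratios[OF assms] by blast
  then have "finite A"
    using finite_kernel_ratios finite_subset by blast
  have imbalance: "circuit_imbalance R C B = Max A"
    by (simp only: circuit_imbalance_def A_def)
  show "circuit_imbalance R C B \<in> insert (Max {}) (kernel_ratios m)"
    unfolding imbalance using \<open>A \<subseteq> kernel_ratios m\<close> Max_in[OF \<open>finite A\<close>]
    by (cases "A = {}") (simp, blast)
  show "\<bar>g i / g j\<bar> \<le> circuit_imbalance R C B"
    if "g \<in> circuits R C B" "i \<in> C" "j \<in> C" "g j \<noteq> 0"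
    unfolding imbalance using \<open>finite A\<close>
  proof (rule Max_ge)
    show "\<bar>g i / g j\<bar> \<in> A"
      unfolding A_def using that by blast
  qed
qed

section \<open>Circuits of the star\<close>

definition star_edge :: "nat \<Rightarrow> nat set" where
  "star_edge i = {0, Suc i}"

lemma inj_star_edge: "inj star_edge"
  by (auto simp: inj_def star_edge_def doubleton_eq_iff)

lemma simple_graph_star: "simple_graph {..m} (star_edge ` {..<m})"
  by (auto simp: simple_graph_def star_edge_def)

lemma card_star: "card (star_edge ` {..<m}) = m"
  using card_image[OF inj_on_subset[OF inj_star_edge subset_UNIV], of "{..<m}"] by simp

lemma star_edge_subset_iff: "star_edge i \<subseteq> insert 0 (Suc ` S) \<longleftrightarrow> i \<in> S"
  by (auto simp: star_edge_def)

lemma rank_rows_of_star: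
  assumes "S \<subseteq> {..<m}"
  shows "insert 0 (Suc ` S) \<in> rank_rows {..m}"
    and "mat_vec (star_edge ` {..<m}) (rank_matrix (star_edge ` {..<m})) x (insert 0 (Suc ` S))
           = (\<Sum>i\<in>S. x (star_edge i))"
proof -
  show "insert 0 (Suc ` S) \<in> rank_rows {..m}"
    using assms by (auto simp: rank_rows_def)
  have "mat_vec (star_edge ` {..<m}) (rank_matrix (star_edge ` {..<m})) x (insert 0 (Suc ` S))
      = (\<Sum>i<m. if i \<in> S then x (star_edge i) else 0)"
    unfolding mat_vec_def using inj_on_subset[OF inj_star_edge subset_UNIV]
    by (auto simp: sum.reindex rank_matrix_def induced_edges_def star_edge_subset_iff
        intro!: sum.cong)
  also have "\<dots> = (\<Sum>i\<in>S. x (star_edge i))"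
    using assms by (simp add: sum.If_cases Int_absorb1)
  finally show "mat_vec (star_edge ` {..<m}) (rank_matrix (star_edge ` {..<m})) x
      (insert 0 (Suc ` S)) = (\<Sum>i\<in>S. x (star_edge i))" .
qed

definition star_vector :: "nat \<Rightarrow> (nat \<Rightarrow> int) \<Rightarrow> nat set \<Rightarrow> real" where
  "star_vector m a c = (if c \<in> star_edge ` {..<m} then of_int (a (the_inv star_edge c)) else 0)"

lemma star_vector_edge: "i < m \<Longrightarrow> star_vector m a (star_edge i) = of_int (a i)"
  by (auto simp: star_vector_def the_inv_f_f[OF inj_star_edge])

text \<open>
  The zero-sum subsets of \<open>a\<close> are the induced edge sets on which \<open>star_vector m a\<close> sums to zero. A
  competitor \<open>x\<close> with smaller support vanishes on them, hence is a multiple of \<open>star_vector m a\<close>. Then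
  both have the same support, for any further rows of the matrix, which is why one argument serves
  (Rank) and (MWF). The entry 1 makes the entries coprime.
\<close>

lemma star_vector_in_circuits:
  fixes B :: "'r \<Rightarrow> nat set \<Rightarrow> real" and m :: nat
  defines "E \<equiv> star_edge ` {..<m}"
  assumes rows: "\<And>U. U \<in> rank_rows {..m} \<Longrightarrow> \<exists>r\<in>R. \<forall>c\<in>E. B r c = rank_matrix E U c"
    and a: "zero_sum_determined m a" and "i < m" "a i = 1"
  shows "star_vector m a \<in> circuits R E B"
proof -
  let ?g = "star_vector m a"
  have edge: "?g (star_edge i) = of_int (a i)" if "i < m" for i
    using star_vector_edge[OF that] .
  have "?g \<noteq> (\<lambda>_. 0)"
    using edge[OF \<open>i < m\<close>] \<open>a i = 1\<close> by (metis of_int_1 zero_neq_one)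
  moreover have "?g \<in> vecs E"
    by (auto simp: vecs_def star_vector_def E_def)
  moreover have "coprime_integral E ?g"
    unfolding coprime_integral_def
  proof (intro exI conjI)
    let ?z = "\<lambda>c. a (the_inv star_edge c)"
    show "\<forall>c\<in>E. ?g c = of_int (?z c)"
      by (auto simp: star_vector_def E_def)
    have "?z (star_edge i) = 1"
      using \<open>a i = 1\<close> by (simp add: the_inv_f_f[OF inj_star_edge])
    then have "1 \<in> ?z ` E"
      using \<open>i < m\<close> unfolding E_def by (metis imageI lessThan_iff)
    then show "Gcd (?z ` E) = 1"
      using Gcd_dvd[of 1 "?z ` E"] Gcd_int_greater_eq_0[of "?z ` E"] by simp
  qed
  moreover have False
    if x: "x \<in> vecs E" "x \<noteq> (\<lambda>_. 0)" and less: "supp R (mat_vec E B x) \<subset> supp R (mat_vec E B ?g)"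
    for x
  proof -
    have "(\<Sum>i\<in>S. x (star_edge i)) = 0" if S: "S \<subseteq> {..<m}" "sum a S = 0" for S
    proof -
      obtain r where r: "r \<in> R" "\<forall>c\<in>E. B r c = rank_matrix E (insert 0 (Suc ` S)) c"
        using rows[OF rank_rows_of_star(1)[OF S(1)]] by blast
      have Br: "mat_vec E B y r = (\<Sum>i\<in>S. y (star_edge i))" for y
        using r(2) rank_rows_of_star(2)[OF S(1), of y, folded E_def]
        by (simp add: mat_vec_def)
      have "mat_vec E B ?g r = of_int (sum a S)"
        unfolding Br of_int_sum using S(1) edge by (intro sum.cong) auto
      then have "mat_vec E B x r = 0"
        using less r(1) S(2) by (auto simp: supp_def)
      then show ?thesis
        by (simp add: Br)
    qed
    then obtain c where c: "\<forall>i<m. x (star_edge i) = c * of_int (a i)"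
      using spec[OF a[unfolded zero_sum_determined_def], of "\<lambda>i. x (star_edge i)"] by blast
    then have xg: "x = (\<lambda>e. c * ?g e)"
      using x(1) edge by (auto simp: fun_eq_iff vecs_def E_def star_vector_def)
    then have "c \<noteq> 0"
      using x(2) by auto
    moreover have "mat_vec E B x r = c * mat_vec E B ?g r" for r
      by (simp add: xg mat_vec_def sum_distrib_left algebra_simps)
    ultimately show False
      using less by (simp add: supp_def)
  qed
  ultimately show ?thesis
    unfolding circuits_def by blast
qed

section \<open>Matrices containing the rank constraints\<close>

text \<open>
  A single edge \<open>e\<close>, taken as a vertex set, induces only itself. So the row of \<open>e\<close> reads off the
  coordinate \<open>e\<close>, and every matrix that contains the rank rows is injective.
\<close>

lemma exponential_worst_case_of_rank_rows:
  fixes R :: "nat set \<Rightarrow> nat set set \<Rightarrow> 'r set" and B :: "nat set set \<Rightarrow> 'r \<Rightarrow> nat set \<Rightarrow> real"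
  assumes entries: "\<And>E r c. B E r c \<in> {-1, 0, 1}"
    and rows: "\<And>V E U. U \<in> rank_rows V \<Longrightarrow> \<exists>r \<in> R V E. \<forall>c\<in>E. B E r c = rank_matrix E U c"
  shows "worst_case (\<lambda>V E. circuit_imbalance (R V E) E (B E)) \<in> \<Omega>(\<lambda>m. 2 ^ m)"
proof -
  let ?\<kappa> = "\<lambda>V E. circuit_imbalance (R V E) E (B E)"
  have finite_edges: "finite E" if "simple_graph V E" for V :: "nat set" and E
    using that finite_subset[of E "Pow V"] by (auto simp: simple_graph_def)
  have inj: "\<exists>r \<in> R V E. mat_vec E (B E) x r \<noteq> 0"
    if G: "simple_graph V E" and x: "x \<in> vecs E" "x \<noteq> (\<lambda>_. 0)" for V E x
  proof -
    obtain e where e: "e \<in> E" "x e \<noteq> 0"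
      using x unfolding vecs_def by fastforce
    then have "e \<in> rank_rows V"
      using G by (auto simp: rank_rows_def simple_graph_def)
    then obtain r where r: "r \<in> R V E" "\<forall>c\<in>E. B E r c = rank_matrix E e c"
      using rows by blast
    have only: "c \<subseteq> e \<longleftrightarrow> c = e" if "c \<in> E" for c
    proof -
      have "card c = 2" "card e = 2"
        using that e(1) G by (auto simp: simple_graph_def)
      then show ?thesis
        by (metis card.infinite card_subset_eq order_refl zero_neq_numeral)
    qed
    have "mat_vec E (B E) x r = (\<Sum>c\<in>E. if c = e then x c else 0)"
      unfolding mat_vec_def using r(2) only
      by (intro sum.cong) (auto simp: rank_matrix_def induced_edges_def)
    also have "\<dots> = x e"
      using e(1) finite_edges[OF G] by simp
    finally show ?thesis
      using r(1) e(2) by (intro bexI[of _ r]) simp_all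
  qed
  have bound: "2 ^ m \<le> 2 ^ 13 * worst_case ?\<kappa> m" if m: "m \<ge> 2" for m
  proof -
    let ?E = "star_edge ` {..<m}"
    let ?values = "{?\<kappa> V E | V E. simple_graph V E \<and> card E = m}"
    have "?\<kappa> V E \<in> insert (Max {}) (kernel_ratios m)" if "simple_graph V E" "card E = m" for V E
      by (rule circuit_imbalance_bounds(1)[OF finite_edges[OF that(1)] that(2) entries inj[OF that(1)]])
    then have "?values \<subseteq> insert (Max {}) (kernel_ratios m)"
      by blast
    then have "finite ?values"
      by (rule finite_subset) (simp add: finite_kernel_ratios)
    then have worst: "?\<kappa> {..m} ?E \<le> worst_case ?\<kappa> m"
      unfolding worst_case_def using simple_graph_star card_star by (intro Max_ge) blast+
    obtain a i where a: "zero_sum_determined m a" "a 0 = 1"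
      and i: "i < m" "(2::int) ^ m \<le> 2 ^ 13 * \<bar>a i\<bar>"
      using exists_zero_sum_determined_large[OF m] by blast
    let ?g = "star_vector m a"
    have g0: "?g (star_edge 0) = 1"
      using star_vector_edge[of 0 m a] a(2) m by simp
    have gi: "?g (star_edge i) = of_int (a i)"
      using star_vector_edge[OF i(1)] .
    have "?g \<in> circuits (R {..m} ?E) ?E (B ?E)"
      using m a by (intro star_vector_in_circuits[where i = 0] rows) auto
    then have "\<bar>?g (star_edge i) / ?g (star_edge 0)\<bar> \<le> ?\<kappa> {..m} ?E"
      using g0 i(1) m
      by (intro circuit_imbalance_bounds(2)[OF finite_edges[OF simple_graph_star] card_star
            entries inj[OF simple_graph_star]]) auto
    then have "of_int \<bar>a i\<bar> \<le> worst_case ?\<kappa> m"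
      using worst by (simp add: g0 gi)
    moreover have "(2::real) ^ m \<le> 2 ^ 13 * of_int \<bar>a i\<bar>"
      using of_int_le_iff[where 'a = real, THEN iffD2, OF i(2)] by simp
    ultimately show ?thesis
      by simp
  qed
  have "1 / 2 ^ 13 * norm ((2::real) ^ m) \<le> norm (worst_case ?\<kappa> m)" if "m \<ge> 2" for m
    using bound[OF that] by simp
  then show ?thesis
    by (intro landau_omega.bigI[of "1 / 2 ^ 13"])
      (auto intro: eventually_sequentiallyI[of 2])
qed

theorem corollary4p1:
  shows "worst_case rank_kappa \<in> \<Omega>(\<lambda>m. 2 ^ m) \<and> worst_case mwf_kappa \<in> \<Omega>(\<lambda>m. 2 ^ m)"
proof
  have "worst_case (\<lambda>V E. circuit_imbalance (rank_rows V) E (rank_matrix E)) \<in> \<Omega>(\<lambda>m. 2 ^ m)"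
    by (rule exponential_worst_case_of_rank_rows) (auto simp: rank_matrix_def)
  then show "worst_case rank_kappa \<in> \<Omega>(\<lambda>m. 2 ^ m)"
    by (simp add: rank_kappa_def[abs_def])
  have "mwf_matrix E r c \<in> {-1, 0, 1}" for E :: "nat set set" and r c
    by (cases r) (auto simp: rank_matrix_def)
  moreover have "\<exists>r \<in> mwf_rows V E. \<forall>c\<in>E. mwf_matrix E r c = rank_matrix E U c"
    if "U \<in> rank_rows V" for V U :: "nat set" and E
    using that by (intro bexI[of _ "Inl U"]) (auto simp: mwf_rows_def)
  ultimately have "worst_case (\<lambda>V E. circuit_imbalance (mwf_rows V E) E (mwf_matrix E)) \<in> \<Omega>(\<lambda>m. 2 ^ m)"
    by (rule exponential_worst_case_of_rank_rows)
  then show "worst_case mwf_kappa \<in> \<Omega>(\<lambda>m. 2 ^ m)"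
    by (simp add: mwf_kappa_def[abs_def])
qed

end
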